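(* Let $(\xi_n)$ satisfy the noise assumption and $f$ satisfy Assumption A (see context), let $\underline\beta_*=\inf\mathcal S$ be as in the context, and let $\delta_0\in(0,K)$, $\alpha_0\in(0,1)$. Suppose that for every $a\in(\alpha_0,1)$ and every $x_0\in(K-\delta_0,K+\delta_0)$ the solution of the deterministic equation $x_{n+1}=(1-a)f(x_n)+a x_n$ satisfies $\lim_{n\to\infty}x_n=K$. Let $$\alpha\in\left(\frac{\alpha_0+\underline\beta_*}{2},\ \underline\beta_*\right),\qquad \ell\in\bigl(\underline\beta_*-\alpha,\ \min\{\alpha-\alpha_0,\,1-\alpha\}\bigr).$$ Then for any $x_0>0$ the solution of $$x_{n+1}=(1-\alpha-\ell\xi_{n+1})f(x_n)+(\alpha+\ell\xi_{n+1})x_n,\qquad n=0,1,2,\dots,$$ satisfies $\lim_{n\to\infty}x_n=K$ almost surely.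
   Context: Noise assumption: $(\xi_n)_{n\in\mathbb N}$ is a sequence of independent identically distributed random variables on a probability space $(\Omega,\mathcal F,\mathbb P)$ with $|\xi_n|\le1$ for all $n$, and $\mathbb P\{\xi_n\in(1-\varepsilon,1]\}>0$ for each $\varepsilon>0$. Assumption A on $f$: $f:[0,\infty)\to[0,\infty)$ is continuous, $f(0)=0$, $f$ has exactly one positive equilibrium (fixed point) $K>0$, which is locally unstable (not Lyapunov stable) for $x_{n+1}=f(x_n)$; $f(x)>x$ for $x\in(0,K)$ and $0<f(x)<x$ for $x\in(K,\infty)$. Notation: $f_m:=\max_{x\in[0,K]}f(x)$; $f^2_m$ denotes the number $f^2_m:=\inf\{f(x):x\in(K,f_m)\}$ (not a square). One has $0<f^2_m<K<f_m$. For $\beta\in[0,1)$, $x\ge0$: $G(\beta,x):=(1-\beta)f(x)+\beta x$, and $G^2(\beta,x):=G(\beta,G(\beta,x))$. Set $\mathcal S:=\{\beta\in(0,1): G^2(\beta,x)>x \text{ for all } x\in(f^2_m,K),\ G^2(\beta,x)<x\text{ for all }x\in(K,f_m)\}$ and $\underline\beta_*:=\inf\mathcal S$. *)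

theory Defs
  imports "HOL-Probability.Probability"
begin

text \<open>
  Maps from \<open>[0,\<infinity>)\<close> to \<open>[0,\<infinity>)\<close> are total functions on \<^typ>\<open>real\<close> of which only the values on
  \<open>{0..}\<close> are constrained.
\<close>

definition lyapunov_stable :: "(real \<Rightarrow> real) \<Rightarrow> real \<Rightarrow> bool" where
  "lyapunov_stable f p \<longleftrightarrow>
     (\<forall>\<epsilon>>0. \<exists>\<delta>>0. \<forall>x\<ge>0. \<bar>x - p\<bar> < \<delta> \<longrightarrow> (\<forall>n. \<bar>(f ^^ n) x - p\<bar> < \<epsilon>))"

definition assumption_A :: "(real \<Rightarrow> real) \<Rightarrow> real \<Rightarrow> bool" where
  "assumption_A f K \<longleftrightarrow>
     (\<forall>x\<ge>0. f x \<ge> 0) \<and> continuous_on {0..} f \<and> f 0 = 0 \<and>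
     K > 0 \<and> (\<forall>x>0. f x = x \<longleftrightarrow> x = K) \<and> \<not> lyapunov_stable f K \<and>
     (\<forall>x\<in>{0<..<K}. f x > x) \<and> (\<forall>x\<in>{K<..}. 0 < f x \<and> f x < x)"

text \<open>The supremum over \<open>{0..K}\<close> is a maximum, since \<open>f\<close> is continuous there.\<close>

definition f_max :: "(real \<Rightarrow> real) \<Rightarrow> real \<Rightarrow> real" where
  "f_max f K = (SUP x\<in>{0..K}. f x)"

definition f2_min :: "(real \<Rightarrow> real) \<Rightarrow> real \<Rightarrow> real" where
  "f2_min f K = (INF x\<in>{K<..<f_max f K}. f x)"

definition G :: "(real \<Rightarrow> real) \<Rightarrow> real \<Rightarrow> real \<Rightarrow> real" where
  "G f \<beta> x = (1 - \<beta>) * f x + \<beta> * x"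

definition S_set :: "(real \<Rightarrow> real) \<Rightarrow> real \<Rightarrow> real set" where
  "S_set f K = {\<beta>\<in>{0<..<1}.
     (\<forall>x\<in>{f2_min f K<..<K}. G f \<beta> (G f \<beta> x) > x) \<and>
     (\<forall>x\<in>{K<..<f_max f K}. G f \<beta> (G f \<beta> x) < x)}"

text \<open>
  The real infimum of the empty set is unspecified. The set is nonempty as soon as \<open>K\<close> attracts a
  fixed neighbourhood under \<open>G f a\<close> for all \<open>a < 1\<close> close to 1: then a small interval around \<open>K\<close> is
  invariant under \<open>G f a\<close>, which forces \<open>a\<close> to be an element.
\<close>

definition beta_low :: "(real \<Rightarrow> real) \<Rightarrow> real \<Rightarrow> real" where
  "beta_low f K = Inf (S_set f K)"

text \<open>Indices start at 1, because \<open>\<xi> 0\<close> does not occur in the stochastic equation.\<close>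

definition noise_assumption :: "'a measure \<Rightarrow> (nat \<Rightarrow> 'a \<Rightarrow> real) \<Rightarrow> bool" where
  "noise_assumption M \<xi> \<longleftrightarrow>
     prob_space M \<and>
     prob_space.indep_vars M (\<lambda>_. borel) \<xi> {1..} \<and>
     (\<forall>n\<ge>1. distr M borel (\<xi> n) = distr M borel (\<xi> 1)) \<and>
     (\<forall>n\<ge>1. \<forall>\<omega>\<in>space M. \<bar>\<xi> n \<omega>\<bar> \<le> 1) \<and>
     (\<forall>n\<ge>1. \<forall>\<epsilon>>0. measure M {\<omega>\<in>space M. \<xi> n \<omega> \<in> {1 - \<epsilon><..1}} > 0)"

end

theory Submission
  imports Defs
begin

text \<open>
  Write \<open>F\<^sub>a = G f a\<close>. A step of \<open>F\<^sub>a\<close> moves a point \<open>x\<close> towards \<open>K\<close>, possibly beyond it, and the move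
  is shorter for larger \<open>a\<close>. Hence for every \<open>a \<ge> b\<close> the next point lies between \<open>x\<close> and \<open>F\<^sub>b x\<close>, so
  an orbit with controls that vary arbitrarily in \<open>[b, d]\<close>, \<open>d < 1\<close>, is governed by the single map
  \<open>F\<^sub>b\<close>. Let \<open>L\<close> be the limit inferior of such an orbit, and suppose that the orbit stays on neither
  side of \<open>K\<close>. A point far to the right must be reached from the left by a jump of size at most that
  of \<open>F\<^sub>b\<close>, and a point far to the left by such a jump from the right. So eventually the orbit lies
  above the minimum of \<open>F\<^sub>b \<circ> F\<^sub>b\<close> over a slightly larger interval than \<open>[L, K]\<close>. If \<open>F\<^sub>b (F\<^sub>b t) > t\<close>
  for \<open>t < K\<close>, this minimum exceeds \<open>L\<close> unless \<open>L = K\<close>. This is the lemma \<open>orbit_tendsto\<close>.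

  It is used twice. Put \<open>b = \<alpha> - l\<close> and \<open>d = \<alpha> + l\<close>; all controls lie in \<open>[b, d]\<close>.

  Near \<open>K\<close>: since \<open>b > \<alpha>\<^sub>0\<close>, the point \<open>K\<close> attracts a neighbourhood under the fixed map \<open>F\<^sub>b\<close>, which forces
  \<open>F\<^sub>b (F\<^sub>b t) > t\<close> to the left of \<open>K\<close> (\<open>attraction_imp_second_iterate_gt\<close>). So some neighbourhood \<open>W\<close>
  of \<open>K\<close> is such that every controlled orbit that enters \<open>W\<close> converges to \<open>K\<close>
  (\<open>trapping_neighbourhood\<close>).

  Far from \<open>K\<close>: the infimum of \<open>S_set\<close> is less than \<open>d\<close>, so some \<open>\<beta> < d\<close> belongs to \<open>S_set\<close>, and under
  the constant control \<open>d\<close> every positive orbit converges to \<open>K\<close>. By compactness there are \<open>N\<close> and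
  \<open>\<epsilon>\<close> such that \<open>N\<close> consecutive controls within \<open>\<epsilon>\<close> of \<open>d\<close> bring every point of an absorbing compact
  interval into \<open>W\<close> (\<open>uniform_arrival\<close>). Such runs of controls are runs of noise values close to 1, and
  almost surely they occur infinitely often (\<open>AE_infinitely_many_blocks\<close>). So almost every
  orbit is trapped.

  For the infimum of \<open>S_set\<close> to be meaningful the set must be nonempty: maps \<open>F\<^sub>a\<close> with \<open>a\<close> close
  to 1 make such small steps that they cannot jump over \<open>K\<close> from outside the neighbourhood that \<open>K\<close>
  attracts (\<open>S_set_nonempty\<close>).
\<close>

section \<open>One step of the controlled map\<close>

text \<open>
  The part of the assumption on \<open>f\<close> that drives orbits towards \<open>K\<close>. Instability of \<open>K\<close> enters only
  through the inequality \<open>f_max f K > K\<close>.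
\<close>
locale crossing_equilibrium =
  fixes f :: "real \<Rightarrow> real" and K :: real
  assumes continuous: "continuous_on {0..} f"
    and nonneg: "\<And>x. x \<ge> 0 \<Longrightarrow> f x \<ge> 0"
    and zero: "f 0 = 0"
    and K_pos: "K > 0"
    and fixed: "f K = K"
    and above: "\<And>x. 0 < x \<Longrightarrow> x < K \<Longrightarrow> x < f x"
    and below: "\<And>x. K < x \<Longrightarrow> f x < x"
begin

lemma G_fixed: "G f a K = K"
  by (simp add: G_def fixed algebra_simps)

lemma G_zero: "G f a 0 = 0"
  by (simp add: G_def zero)

lemma G_nonneg: "0 \<le> a \<Longrightarrow> a \<le> 1 \<Longrightarrow> 0 \<le> x \<Longrightarrow> 0 \<le> G f a x"
  by (simp add: G_def nonneg)

lemma G_pos: "0 < a \<Longrightarrow> a \<le> 1 \<Longrightarrow> 0 < x \<Longrightarrow> 0 < G f a x"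
  unfolding G_def by (intro add_nonneg_pos mult_nonneg_nonneg mult_pos_pos nonneg) auto

lemma G_eq_move: "G f a x = x + (1 - a) * (f x - x)"
  by (simp add: G_def algebra_simps)

lemma le_f: "0 \<le> x \<Longrightarrow> x \<le> K \<Longrightarrow> x \<le> f x"
  using above[of x] zero fixed by (cases "x = 0"; cases "x = K") auto

lemma f_le: "K \<le> x \<Longrightarrow> f x \<le> x"
  using below[of x] fixed by (cases "x = K") auto

lemma G_ge_self: "a \<le> 1 \<Longrightarrow> 0 \<le> x \<Longrightarrow> x \<le> K \<Longrightarrow> x \<le> G f a x"
  using le_f[of x] by (simp add: G_eq_move)

lemma G_gt_self: "a < 1 \<Longrightarrow> 0 < x \<Longrightarrow> x < K \<Longrightarrow> x < G f a x"
  using above[of x] by (simp add: G_eq_move)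

lemma G_le_self: "a \<le> 1 \<Longrightarrow> K \<le> x \<Longrightarrow> G f a x \<le> x"
  using f_le[of x] mult_nonneg_nonneg[of "1 - a" "x - f x"] by (simp add: G_eq_move algebra_simps)

lemma G_lt_self: "a < 1 \<Longrightarrow> K < x \<Longrightarrow> G f a x < x"
  using below[of x] mult_pos_pos[of "1 - a" "x - f x"] by (simp add: G_eq_move algebra_simps)

lemma G_antimono_left: "b \<le> a \<Longrightarrow> 0 \<le> x \<Longrightarrow> x \<le> K \<Longrightarrow> G f a x \<le> G f b x"
  using le_f[of x] mult_right_mono[of "1 - a" "1 - b" "f x - x"] by (simp add: G_eq_move)

lemma G_mono_right: "b \<le> a \<Longrightarrow> K \<le> x \<Longrightarrow> G f b x \<le> G f a x"
  using f_le[of x] mult_right_mono[of "1 - a" "1 - b" "x - f x"]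
  by (simp add: G_eq_move algebra_simps)

lemma continuous_on_G: "continuous_on {0..} (G f a)"
  unfolding G_def by (intro continuous_intros continuous)

lemma continuous_on_G2:
  assumes "0 \<le> a" "a \<le> 1"
  shows "continuous_on {0..} (\<lambda>x. G f a (G f a x))"
  by (rule continuous_on_compose2[OF continuous_on_G continuous_on_G])
    (use G_nonneg assms in auto)

lemma funpow_G_fixed: "(G f a ^^ n) K = K"
  by (induction n) (simp_all add: G_fixed)

lemma funpow_G_nonneg: "0 \<le> a \<Longrightarrow> a \<le> 1 \<Longrightarrow> 0 \<le> x \<Longrightarrow> 0 \<le> (G f a ^^ n) x"
  by (induction n) (simp_all add: G_nonneg)

lemma continuous_on_funpow_G:
  assumes "0 \<le> a" "a \<le> 1"
  shows "continuous_on {0..} (G f a ^^ n)"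
proof (induction n)
  case (Suc n)
  then show ?case
    using continuous_on_compose2[OF continuous_on_G, of "{0..}" "G f a ^^ n" a]
      funpow_G_nonneg[OF assms] by (auto simp: o_def)
qed (simp add: id_def)

section \<open>Attraction and the second iterate\<close>

text \<open>
  Suppose \<open>h = F\<^sub>a \<circ> F\<^sub>a\<close> satisfies \<open>h t \<le> t\<close> for some \<open>t\<close> in the attracted interval, and let \<open>p\<close> be the
  largest fixed point of \<open>h\<close> in \<open>[0, t]\<close>. Then \<open>h\<close> does not increase points of \<open>(p, t]\<close>. If the orbit
  of \<open>t\<close> stays above \<open>p\<close>, it never exceeds \<open>t\<close> and misses \<open>K\<close>. Otherwise some power \<open>h ^^ n\<close> takes \<open>t\<close>
  to a point not above \<open>p\<close> while it fixes \<open>K\<close>, so it maps a point between \<open>t\<close> and \<open>K\<close> exactly to \<open>p\<close>,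
  and that point is not attracted by \<open>K\<close> either.
\<close>
lemma attraction_imp_second_iterate_gt:
  assumes a: "0 \<le> a" "a \<le> 1" and c: "0 \<le> c"
    and attract: "\<And>y. c < y \<Longrightarrow> y < K \<Longrightarrow> (\<lambda>n. (G f a ^^ n) y) \<longlonglongrightarrow> K"
    and t: "c < t" "t < K"
  shows "t < G f a (G f a t)"
proof (rule ccontr)
  define h where "h = G f a ^^ 2"
  have h_eq: "h y = G f a (G f a y)" for y by (simp add: h_def numeral_2_eq_2)
  have h_pow: "h ^^ n = G f a ^^ (2 * n)" for n by (simp add: h_def funpow_mult)
  have h_lim: "(\<lambda>n. (h ^^ n) y) \<longlonglongrightarrow> K" if "c < y" "y < K" for y
    using LIMSEQ_subseq_LIMSEQ[OF attract[OF that], of "\<lambda>n. 2 * n"]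
    by (simp add: h_pow o_def strict_mono_def)
  have h_cont: "continuous_on {0..} h"
    using continuous_on_funpow_G[OF a] by (simp add: h_def)
  assume "\<not> ?thesis"
  then have ht: "h t \<le> t" by (simp add: h_eq)
  define P where "P = {q \<in> {0..t}. h q = q}"
  have "closed {q \<in> {0..t}. h q - q = 0}"
    by (intro continuous_closed_preimage_constant)
      (auto intro!: continuous_intros continuous_on_subset[OF h_cont])
  then have "closed P" by (simp add: P_def)
  then have "compact P" by (auto simp: P_def compact_eq_bounded_closed intro: bounded_subset[of "{0..t}"])
  moreover have "0 \<in> P" using t c by (auto simp: P_def h_eq G_zero)
  \<comment> \<open>The fixed point 0 of \<open>f\<close> guarantees that there is a largest fixed point \<open>p\<close>.\<close>
  ultimately obtain p where p: "p \<in> P" and p_max: "\<And>q. q \<in> P \<Longrightarrow> q \<le> p"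
    using compact_attains_sup[of P] by blast
  have p': "0 \<le> p" "p \<le> t" "h p = p" using p by (auto simp: P_def)
  have stuck: "(h ^^ n) p = p" for n by (induction n) (simp_all add: p')
  have h_less: "h r \<le> r" if r: "p < r" "r \<le> t" for r
  proof (rule ccontr)
    assume "\<not> ?thesis"
    then have "\<exists>q\<ge>r. q \<le> t \<and> h q - q = 0"
      using ht r p'
      by (intro IVT2') (auto intro!: continuous_intros continuous_on_subset[OF h_cont])
    then obtain q where "r \<le> q" "q \<le> t" "h q = q" by auto
    then show False using p_max[of q] r p' by (simp add: P_def)
  qed
  show False
  proof (cases "\<exists>n. (h ^^ n) t \<le> p")
    case True
    then obtain n where n: "(h ^^ n) t \<le> p" ..
    have hK: "(h ^^ n) K = K" unfolding h_pow by (rule funpow_G_fixed)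
    have "continuous_on {t..K} (h ^^ n)"
      unfolding h_pow by (rule continuous_on_subset[OF continuous_on_funpow_G[OF a]]) (use t c in auto)
    then obtain s where s: "t \<le> s" "s \<le> K" "(h ^^ n) s = p"
      using IVT'[of "h ^^ n" t p K] n p' t hK by auto
    have "s \<noteq> K" using s p' t hK by auto
    then have "(\<lambda>m. (h ^^ (m + n)) s) \<longlonglongrightarrow> K"
      by (intro LIMSEQ_ignore_initial_segment[OF h_lim]) (use s t in auto)
    then have "(\<lambda>m. p) \<longlonglongrightarrow> K" by (simp add: funpow_add s stuck)
    then show False using p' t by (simp add: LIMSEQ_const_iff)
  next
    case False
    have "(h ^^ n) t \<le> t" for n
    proof (induction n)
      case (Suc n)
      have "p < (h ^^ n) t" using False by (simp add: not_le)
      then have "h ((h ^^ n) t) \<le> (h ^^ n) t" using h_less Suc.IH by blast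
      then show ?case using Suc.IH by simp
    qed simp
    then show False using LIMSEQ_le_const2[OF h_lim[OF t], of t] t by auto
  qed
qed

section \<open>Orbits under varying control\<close>
definition controlled_orbit :: "real \<Rightarrow> real \<Rightarrow> (nat \<Rightarrow> real) \<Rightarrow> (nat \<Rightarrow> real) \<Rightarrow> bool" where
  "controlled_orbit b d a x \<longleftrightarrow>
     x 0 > 0 \<and> (\<forall>n. a n \<in> {b..d} \<and> x (Suc n) = G f (a n) (x n))"

context
  fixes b d :: real
  assumes b_pos: "0 < b" and d_less: "d < 1"
begin

lemma orbit_pos:
  assumes "controlled_orbit b d a x"
  shows "0 < x n"
proof (induction n)
  case (Suc n)
  have "a n \<in> {b..d}" "x (Suc n) = G f (a n) (x n)"
    using assms by (auto simp: controlled_orbit_def)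
  then show ?case using G_pos[of "a n" "x n"] Suc b_pos d_less by auto
qed (use assms in \<open>simp add: controlled_orbit_def\<close>)

lemma orbit_shift:
  assumes "controlled_orbit b d a x"
  shows "controlled_orbit b d (\<lambda>n. a (m + n)) (\<lambda>n. x (m + n))"
  using assms orbit_pos[OF assms] by (auto simp: controlled_orbit_def)

lemma orbit_left:
  assumes "controlled_orbit b d a x" "x n \<le> K"
  shows "x n \<le> x (Suc n)" "x (Suc n) \<le> G f b (x n)"
  using assms orbit_pos[OF assms(1), of n] G_ge_self[of "a n" "x n"]
    G_antimono_left[of b "a n" "x n"] d_less
  by (auto simp: controlled_orbit_def dest!: spec[of _ n])

lemma orbit_right:
  assumes "controlled_orbit b d a x" "K \<le> x n"
  shows "x (Suc n) \<le> x n" "G f b (x n) \<le> x (Suc n)"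
  using assms G_le_self[of "a n" "x n"] G_mono_right[of b "a n" "x n"] d_less
  by (auto simp: controlled_orbit_def dest!: spec[of _ n])

text \<open>
  Since the controls stay away from 1, each step covers at least the fraction \<open>1 - d\<close> of the distance
  from \<open>x n\<close> to \<open>f (x n)\<close>, so a positive limit is a fixed point of \<open>f\<close>.
\<close>
lemma orbit_limit_eq:
  assumes x: "controlled_orbit b d a x" and p: "x \<longlonglongrightarrow> p" "0 < p"
  shows "x \<longlonglongrightarrow> K"
proof -
  have "\<bar>f (x n) - x n\<bar> * (1 - d) \<le> \<bar>x (Suc n) - x n\<bar>" for n
  proof -
    have "a n \<le> d" and move: "x (Suc n) - x n = (1 - a n) * (f (x n) - x n)"
      using x by (auto simp: controlled_orbit_def G_eq_move)
    then show ?thesis unfolding move abs_mult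
      using d_less by (subst mult.commute) (auto intro!: mult_right_mono)
  qed
  moreover have "(\<lambda>n. f (x n)) \<longlonglongrightarrow> f p"
    by (rule continuous_on_tendsto_compose[OF continuous p(1)])
      (use p orbit_pos[OF x] in \<open>auto intro!: always_eventually less_imp_le\<close>)
  then have "(\<lambda>n. \<bar>f (x n) - x n\<bar> * (1 - d)) \<longlonglongrightarrow> \<bar>f p - p\<bar> * (1 - d)"
    by (intro tendsto_intros p)
  moreover have "(\<lambda>n. \<bar>x (Suc n) - x n\<bar>) \<longlonglongrightarrow> \<bar>p - p\<bar>"
    by (intro tendsto_intros p LIMSEQ_Suc)
  ultimately have "\<bar>f p - p\<bar> * (1 - d) \<le> \<bar>p - p\<bar>"
    by (blast intro: LIMSEQ_le)
  then have "f p = p" using d_less by (simp add: mult_le_0_iff)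
  then have "p = K" using above[of p] below[of p] p(2) by force
  then show ?thesis using p by simp
qed

lemma one_sided_orbit_tendsto:
  assumes x: "controlled_orbit b d a x"
    and "(\<forall>n\<ge>m. x n \<le> K) \<or> (\<forall>n\<ge>m. K \<le> x n)"
  shows "x \<longlonglongrightarrow> K"
proof -
  let ?y = "\<lambda>n. x (m + n)"
  have "\<exists>p>0. ?y \<longlonglongrightarrow> p"
    using assms(2)
  proof
    assume le: "\<forall>n\<ge>m. x n \<le> K"
    then have "incseq ?y" by (intro incseq_SucI) (use orbit_left(1)[OF x] in auto)
    moreover obtain p where "?y \<longlonglongrightarrow> p"
      using incseq_convergent[OF \<open>incseq ?y\<close>, of K] le by (meson le_add1)
    ultimately show ?thesis
      using incseq_le[of ?y p 0] orbit_pos[OF x, of m] by (intro exI[of _ p]) auto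
  next
    assume ge: "\<forall>n\<ge>m. K \<le> x n"
    then have "decseq ?y" by (intro decseq_SucI) (use orbit_right(1)[OF x] in auto)
    then obtain p where "?y \<longlonglongrightarrow> p"
      using decseq_convergent[of ?y K] ge by (meson le_add1)
    moreover have "K \<le> p" by (rule LIMSEQ_le_const[OF \<open>?y \<longlonglongrightarrow> p\<close>]) (use ge in auto)
    ultimately show ?thesis using K_pos by (intro exI[of _ p]) auto
  qed
  then obtain p where "p > 0" "?y \<longlonglongrightarrow> p" by blast
  then have "(\<lambda>n. x (n + m)) \<longlonglongrightarrow> p" by (simp add: add.commute)
  then have "x \<longlonglongrightarrow> p" by (rule LIMSEQ_offset)
  then show ?thesis by (rule orbit_limit_eq[OF x _ \<open>p > 0\<close>])
qed

text \<open>
  Above \<open>K\<close> an orbit can only descend, so after a visit below \<open>K\<close> its height is limited by the longest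
  jump from \<open>[y, K]\<close>. The next lemma is the mirror image.
\<close>
lemma orbit_eventually_le:
  assumes x: "controlled_orbit b d a x" and y: "y \<le> K"
    and ge: "\<And>n. m \<le> n \<Longrightarrow> y \<le> x n"
    and visit: "m \<le> k" "x k \<le> K"
    and u: "\<And>t. y \<le> t \<Longrightarrow> t \<le> K \<Longrightarrow> G f b t \<le> u"
    and n: "k \<le> n"
  shows "x n \<le> u"
  using n
proof (induction n rule: dec_induct)
  case base
  show ?case using u[OF y order_refl] visit by (simp add: G_fixed)
next
  case (step n)
  show ?case
  proof (cases "x n \<le> K")
    case True
    then show ?thesis using orbit_left(2)[OF x True] u[OF ge True] visit step by force
  next
    case False
    then show ?thesis using orbit_right(1)[OF x, of n] step by auto
  qed
qed

lemma orbit_eventually_ge: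
  assumes x: "controlled_orbit b d a x" and z: "K \<le> z"
    and le: "\<And>n. m \<le> n \<Longrightarrow> x n \<le> z"
    and visit: "m \<le> k" "K \<le> x k"
    and v: "\<And>t. K \<le> t \<Longrightarrow> t \<le> z \<Longrightarrow> v \<le> G f b t"
    and n: "k \<le> n"
  shows "v \<le> x n"
  using n
proof (induction n rule: dec_induct)
  case base
  show ?case using v[OF order_refl z] visit by (simp add: G_fixed)
next
  case (step n)
  show ?case
  proof (cases "K \<le> x n")
    case True
    then show ?thesis using orbit_right(2)[OF x True] v[OF True le] visit step by force
  next
    case False
    then show ?thesis using orbit_left(1)[OF x, of n] step by auto
  qed
qed

text \<open>
  All points between \<open>K\<close> and the maximum of \<open>F\<^sub>b\<close> on \<open>[y, K]\<close> are values of \<open>F\<^sub>b\<close> there. This turns a bound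
  on \<open>F\<^sub>b \<circ> F\<^sub>b\<close> over \<open>[y, K]\<close> into a bound on jumps back from the right of \<open>K\<close>.
\<close>
lemma left_maximum:
  assumes "0 \<le> y" "y \<le> K"
  obtains u where "\<And>t. y \<le> t \<Longrightarrow> t \<le> K \<Longrightarrow> G f b t \<le> u"
    and "\<And>z. K \<le> z \<Longrightarrow> z \<le> u \<Longrightarrow> \<exists>t. y \<le> t \<and> t \<le> K \<and> G f b t = z"
proof -
  have cont: "continuous_on {y..K} (G f b)"
    by (rule continuous_on_subset[OF continuous_on_G]) (use assms in auto)
  obtain s where s: "s \<in> {y..K}" "\<And>t. t \<in> {y..K} \<Longrightarrow> G f b t \<le> G f b s"
    using continuous_attains_sup[OF _ _ cont] assms by auto
  show thesis
  proof
    show "G f b t \<le> G f b s" if "y \<le> t" "t \<le> K" for t using s that by auto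
    show "\<exists>t. y \<le> t \<and> t \<le> K \<and> G f b t = z" if "K \<le> z" "z \<le> G f b s" for z
    proof -
      have "\<exists>t\<ge>s. t \<le> K \<and> G f b t = z"
        by (rule IVT2') (use that s in \<open>auto simp: G_fixed intro: continuous_on_subset[OF cont]\<close>)
      then obtain t where "s \<le> t" "t \<le> K" "G f b t = z" by blast
      then show ?thesis using s(1) by (intro exI[of _ t]) auto
    qed
  qed
qed

text \<open>
  A bound on the second iterate of the single map \<open>F\<^sub>b\<close> suffices for all control sequences. Orbits that
  stay on one side of \<open>K\<close> are monotone. For the others, the supremum \<open>L\<close> of the eventual lower bounds can
  be improved by two excursions, to the right and back, as long as \<open>L < K\<close>. Once \<open>L = K\<close>, the upper
  bound for jumps from just below \<open>K\<close> gives the convergence.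
\<close>
lemma orbit_tendsto:
  assumes x: "controlled_orbit b d a x"
    and ge: "\<And>n. m \<le> n \<Longrightarrow> c \<le> x n"
    and G2: "\<And>t. c \<le> t \<Longrightarrow> 0 < t \<Longrightarrow> t < K \<Longrightarrow> t < G f b (G f b t)"
  shows "x \<longlonglongrightarrow> K"
proof (rule ccontr)
  assume notlim: "\<not> x \<longlonglongrightarrow> K"
  have "b \<le> a 0" "a 0 \<le> d" using x by (auto simp: controlled_orbit_def)
  then have b1: "b \<le> 1" using d_less by simp
  have "\<exists>n\<ge>k. x n < K" "\<exists>n\<ge>k. K < x n" for k
    using one_sided_orbit_tendsto[OF x] notlim by (meson not_le)+
  then have visits: "\<exists>n\<ge>k. x n \<le> K" "\<exists>n\<ge>k. K \<le> x n" and strict: "\<exists>n\<ge>k. x n < K" for k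
    by (meson less_imp_le)+
  define E where "E = {y. eventually (\<lambda>n. y \<le> x n) sequentially}"
  define L where "L = Sup E"
  have E_le: "y \<le> K" if "y \<in> E" for y
    using that strict unfolding E_def eventually_sequentially by (force simp: not_le)
  have "c \<in> E" using ge by (auto simp: E_def eventually_sequentially)
  then have upper: "y \<le> L" if "y \<in> E" for y
    unfolding L_def using that E_le by (intro cSup_upper) (auto simp: bdd_above_def)
  have below_L: "y \<in> E" if y: "y < L" for y
  proof -
    obtain y' where "y' \<in> E" "y < y'"
      using less_cSupD[of E y] y \<open>c \<in> E\<close> unfolding L_def by blast
    then show ?thesis unfolding E_def by (auto elim!: eventually_mono)
  qed
  have L_le: "L \<le> K" unfolding L_def using \<open>c \<in> E\<close> E_le by (intro cSup_least) auto
  have bound: "\<exists>k. \<forall>n\<ge>k. x n \<le> u"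
    if y: "y \<in> E" and u: "\<And>t. y \<le> t \<Longrightarrow> t \<le> K \<Longrightarrow> G f b t \<le> u" for y u
  proof -
    obtain m' where m': "\<And>n. m' \<le> n \<Longrightarrow> y \<le> x n"
      using y by (auto simp: E_def eventually_sequentially)
    obtain k where "m' \<le> k" "x k \<le> K" using visits(1) by blast
    then show ?thesis using orbit_eventually_le[OF x E_le[OF y] m' _ _ u] by blast
  qed
  \<comment> \<open>A first excursion to the right and back from a bounded range yields a positive lower bound;
    positivity matters because 0 is fixed.\<close>
  have L_pos: "0 < L"
  proof -
    obtain u where u: "\<And>t. 0 \<le> t \<Longrightarrow> t \<le> K \<Longrightarrow> G f b t \<le> u"
      using left_maximum[of 0] K_pos by (metis less_imp_le order_refl)
    have "0 \<in> E" using orbit_pos[OF x] by (auto simp: E_def intro!: always_eventually less_imp_le)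
    then obtain k where k: "\<forall>n\<ge>k. x n \<le> u" using bound u by blast
    have Ku: "K \<le> u" using u[of K] K_pos by (simp add: G_fixed)
    have "continuous_on {K..u} (G f b)"
      by (rule continuous_on_subset[OF continuous_on_G]) (use K_pos in auto)
    then obtain s where s: "s \<in> {K..u}" "\<And>t. t \<in> {K..u} \<Longrightarrow> G f b s \<le> G f b t"
      using continuous_attains_inf[of "{K..u}" "G f b"] Ku by auto
    obtain k' where "k \<le> k'" "K \<le> x k'" using visits(2) by blast
    then have "G f b s \<le> x n" if "k' \<le> n" for n
      using orbit_eventually_ge[OF x Ku, of k k' "G f b s" n] k s that by auto
    then have "G f b s \<in> E" by (auto simp: E_def eventually_sequentially)
    moreover have "0 < G f b s" using G_pos[of b s] b_pos b1 s K_pos by auto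
    ultimately show ?thesis using upper by (meson less_le_trans)
  qed
  have "L = K"
  proof (rule ccontr)
    assume "L \<noteq> K"
    then have LK: "L < K" using L_le by simp
    let ?h = "\<lambda>t. G f b (G f b t)"
    have h_cont: "continuous_on {0..} ?h" using continuous_on_G2 b_pos b1 by simp
    have h_gt: "L < ?h t" if "L \<le> t" "t \<le> K" for t
      using G2[of t] upper[OF \<open>c \<in> E\<close>] that L_pos LK
      by (cases "t = K") (force simp: G_fixed)+
    have "isCont ?h L"
      by (rule continuous_on_interior[OF h_cont]) (use L_pos in auto)
    then have "(?h \<longlongrightarrow> ?h L) (nhds L)"
      using tendsto_at_iff_tendsto_nhds[of ?h L] by (simp add: isCont_def)
    then have "eventually (\<lambda>t. L < ?h t) (nhds L)"
      using h_gt[of L] LK by (intro order_tendstoD(1)[of ?h "?h L"]) auto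
    then obtain r where r: "r > 0" "\<And>t. \<bar>t - L\<bar> < r \<Longrightarrow> L < ?h t"
      unfolding eventually_nhds_metric dist_real_def by blast
    \<comment> \<open>The argument starts from an eventual lower bound, so it needs a point \<open>y < L\<close>; continuity at \<open>L\<close>
      provides one above which the second iterate still exceeds \<open>L\<close>.\<close>
    define y where "y = max (L / 2) (L - r / 2)"
    have y: "0 < y" "y < L" "L - r < y" using L_pos r(1) by (auto simp: y_def less_max_iff_disj)
    have y0: "0 \<le> y" and yK: "y \<le> K" using y LK by auto
    have h_gt': "L < ?h t" if "y \<le> t" "t \<le> K" for t
      using h_gt[of t] r(2)[of t] that y by (cases "L \<le> t") simp_all
    have "continuous_on {y..K} ?h"
      by (rule continuous_on_subset[OF h_cont]) (use y in auto)
    then obtain s where s: "s \<in> {y..K}" "\<And>t. t \<in> {y..K} \<Longrightarrow> ?h s \<le> ?h t"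
      using continuous_attains_inf[of "{y..K}" ?h] y LK by auto
    obtain u where u: "\<And>t. y \<le> t \<Longrightarrow> t \<le> K \<Longrightarrow> G f b t \<le> u"
      and onto: "\<And>z. K \<le> z \<Longrightarrow> z \<le> u \<Longrightarrow> \<exists>t. y \<le> t \<and> t \<le> K \<and> G f b t = z"
      using left_maximum[of y] y0 yK by metis
    obtain k where k: "\<forall>n\<ge>k. x n \<le> u" using bound[OF below_L[OF y(2)] u] by blast
    have Ku: "K \<le> u" using u[of K] y LK by (simp add: G_fixed)
    obtain k' where "k \<le> k'" "K \<le> x k'" using visits(2) by blast
    moreover have "?h s \<le> G f b z" if "K \<le> z" "z \<le> u" for z
      using onto[OF that] s(2) by auto
    ultimately have "?h s \<le> x n" if "k' \<le> n" for n
      using orbit_eventually_ge[OF x Ku, of k k' "?h s" n] k that by auto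
    then have "?h s \<in> E" by (auto simp: E_def eventually_sequentially)
    then have "?h s \<le> L" by (rule upper)
    then show False using h_gt'[of s] s(1) by simp
  qed
  have "x \<longlonglongrightarrow> K"
  proof (rule order_tendstoI)
    fix y assume "y < K"
    then have "(y + K) / 2 \<in> E" using below_L \<open>L = K\<close> by auto
    then show "eventually (\<lambda>n. y < x n) sequentially"
      unfolding E_def using \<open>y < K\<close> by (auto elim!: eventually_mono)
  next
    fix z assume z: "K < z"
    have "isCont (G f b) K"
      by (rule continuous_on_interior[OF continuous_on_G]) (use K_pos in auto)
    then have "(G f b \<longlongrightarrow> K) (nhds K)"
      using tendsto_at_iff_tendsto_nhds[of "G f b" K] by (simp add: isCont_def G_fixed)
    then have "eventually (\<lambda>t. G f b t < (K + z) / 2) (nhds K)"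
      using z by (intro order_tendstoD) auto
    then obtain r where r: "r > 0" "\<And>t. \<bar>t - K\<bar> < r \<Longrightarrow> G f b t < (K + z) / 2"
      unfolding eventually_nhds_metric dist_real_def by blast
    have "K - r / 2 \<in> E" using below_L \<open>L = K\<close> r(1) by auto
    moreover have "G f b t \<le> (K + z) / 2" if "K - r / 2 \<le> t" "t \<le> K" for t
      using r(2)[of t] that r(1) by simp
    ultimately obtain k where k: "\<forall>n\<ge>k. x n \<le> (K + z) / 2" using bound by blast
    have "(K + z) / 2 < z" using z by simp
    then show "eventually (\<lambda>n. x n < z) sequentially"
      using k by (intro eventually_sequentiallyI[of k]) (meson le_less_trans)
  qed
  then show False using notlim by simp
qed

section \<open>Trapping near the equilibrium\<close>

text \<open>
  For \<open>y < K\<close> the interval from \<open>y\<close> to the maximum \<open>u\<close> of \<open>F\<^sub>b\<close> on \<open>[y, K]\<close> is invariant, because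
  \<open>F\<^sub>b\<close> maps \<open>[K, u]\<close> to values of the second iterate on \<open>[y, K]\<close>, which are at least \<open>y\<close>. As \<open>u = K\<close> is possible, the right end
  is moved a little beyond \<open>K\<close> so that \<open>K\<close> is an interior point.
\<close>
lemma trapping_neighbourhood:
  assumes c: "0 \<le> c" "c < K"
    and G2: "\<And>t. c < t \<Longrightarrow> t < K \<Longrightarrow> t < G f b (G f b t)"
  obtains p q where "p < K" "K < q"
    and "\<And>a x. controlled_orbit b d a x \<Longrightarrow> x 0 \<in> {p<..<q} \<Longrightarrow> x \<longlonglongrightarrow> K"
proof -
  define y where "y = (c + K) / 2"
  have y: "0 < y" "c < y" "y < K" using c by (auto simp: y_def)
  have G2': "y \<le> G f b (G f b t)" if "y \<le> t" "t \<le> K" for t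
    using G2[of t] that y by (cases "t = K") (auto simp: G_fixed)
  obtain u where u: "\<And>t. y \<le> t \<Longrightarrow> t \<le> K \<Longrightarrow> G f b t \<le> u"
    and onto: "\<And>z. K \<le> z \<Longrightarrow> z \<le> u \<Longrightarrow> \<exists>t. y \<le> t \<and> t \<le> K \<and> G f b t = z"
    using left_maximum[of y] y by (metis less_imp_le)
  have "isCont (G f b) K"
    by (rule continuous_on_interior[OF continuous_on_G]) (use K_pos in auto)
  then have "(G f b \<longlongrightarrow> K) (nhds K)"
    using tendsto_at_iff_tendsto_nhds[of "G f b" K] by (simp add: isCont_def G_fixed)
  then have "eventually (\<lambda>t. y < G f b t) (nhds K)"
    using y by (intro order_tendstoD) auto
  then obtain r where r: "r > 0" "\<And>t. \<bar>t - K\<bar> < r \<Longrightarrow> y < G f b t"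
    unfolding eventually_nhds_metric dist_real_def by blast
  define z where "z = max u (K + r / 2)"
  have right: "y \<le> G f b t" if "K \<le> t" "t \<le> z" for t
  proof (cases "t \<le> u")
    case True
    then show ?thesis using onto[OF that(1)] G2' by blast
  next
    case False
    then have "t \<le> K + r / 2" using that by (auto simp: z_def)
    then show ?thesis using r(1) r(2)[of t] that by auto
  qed
  show thesis
  proof
    show "y < K" "K < z" using y r(1) by (auto simp: z_def)
    fix a x
    assume x: "controlled_orbit b d a x" and x0: "x 0 \<in> {y<..<z}"
    have "y \<le> x n \<and> x n \<le> z" for n
    proof (induction n)
      case (Suc n)
      show ?case
      proof (cases "x n \<le> K")
        case True
        have "u \<le> z" by (simp add: z_def)
        then show ?thesis using orbit_left[OF x True] u[of "x n"] Suc True by linarith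
      next
        case False
        then show ?thesis using orbit_right[OF x, of n] right[of "x n"] Suc by linarith
      qed
    qed (use x0 in auto)
    then show "x \<longlonglongrightarrow> K"
      using G2 y by (intro orbit_tendsto[OF x, of 0 y]) auto
  qed
qed

section \<open>Absorption and arrival\<close>

text \<open>
  An orbit that keeps crossing \<open>K\<close> has landed below \<open>e\<close> from the left and then above the lower end
  from the right. The lower end lies strictly above \<open>v\<close> when \<open>v < K\<close>, since \<open>b > 0\<close>; this makes the open
  interval in the definition of \<open>S_set\<close> sufficient.
\<close>
lemma orbit_tendsto_or_absorbed:
  assumes x: "controlled_orbit b d a x"
    and e: "K < e" "\<And>t. 0 \<le> t \<Longrightarrow> t \<le> K \<Longrightarrow> f t \<le> e"
    and v: "\<And>t. K < t \<Longrightarrow> t < e \<Longrightarrow> v \<le> f t"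
  shows "x \<longlonglongrightarrow> K \<or> (\<exists>m. \<forall>n\<ge>m. x n \<in> {min K ((1 - b) * v + b * K)..e})"
proof (subst disj_commute, rule disjCI)
  let ?c = "min K ((1 - b) * v + b * K)"
  assume "\<not> x \<longlonglongrightarrow> K"
  then have visits: "\<exists>n\<ge>k. x n < K" "\<exists>n\<ge>k. K < x n" for k
    using one_sided_orbit_tendsto[OF x] by (meson not_le)+
  obtain m where m: "x m < K" using visits(1) by blast
  have less_e: "x n < e" if "m \<le> n" for n
    using that
  proof (induction n rule: dec_induct)
    case base
    show ?case using m e(1) by simp
  next
    case (step n)
    have a: "b \<le> a n" "a n \<le> d" "x (Suc n) = G f (a n) (x n)"
      using x by (auto simp: controlled_orbit_def)
    show ?case
    proof (cases "x n \<le> K")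
      case True
      have "(1 - a n) * f (x n) \<le> (1 - a n) * e"
        using a d_less e(2)[OF _ True] orbit_pos[OF x, of n] by (intro mult_left_mono) auto
      moreover have "a n * x n < a n * e"
        using a b_pos True e(1) by (intro mult_strict_left_mono) auto
      ultimately show ?thesis by (simp add: a(3) G_def algebra_simps)
    next
      case False
      then show ?thesis using orbit_right(1)[OF x, of n] step by auto
    qed
  qed
  obtain k where k: "m \<le> k" "K < x k" using visits(2) by blast
  have "?c \<le> x n" if "k \<le> n" for n
    using that
  proof (induction n rule: dec_induct)
    case base
    show ?case using k by simp
  next
    case (step n)
    show ?case
    proof (cases "x n \<le> K")
      case True
      then show ?thesis using orbit_left(1)[OF x, of n] step by auto
    next
      case False
      have "b \<le> a n" "a n \<le> d" using x by (auto simp: controlled_orbit_def)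
      then have "(1 - b) * v \<le> (1 - b) * f (x n)"
        using v[of "x n"] less_e[of n] False k step d_less by (intro mult_left_mono) auto
      moreover have "b * K \<le> b * x n" using False b_pos by simp
      ultimately have "(1 - b) * v + b * K \<le> G f b (x n)" by (simp add: G_def)
      then show ?thesis using orbit_right(2)[OF x, of n] False by auto
    qed
  qed
  then show "\<exists>m. \<forall>n\<ge>m. x n \<in> {?c..e}"
    using less_e k(1) by (intro exI[of _ k]) (auto intro: less_imp_le)
qed

text \<open>
  Otherwise there are orbits that start in \<open>[c, e]\<close> and avoid \<open>W\<close> for longer and longer times although
  their controls approach \<open>s\<close>. Along a subsequence the starting points converge, by continuity so do all
  later points, and the limit is an orbit of \<open>F\<^sub>s\<close> that never meets the open set \<open>W\<close>.
\<close>
lemma uniform_arrival: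
  assumes hit: "\<And>y. y \<in> {c..e} \<Longrightarrow> \<exists>n. (G f s ^^ n) y \<in> W"
    and W: "open W" and c: "0 \<le> c"
  obtains N \<epsilon> where "\<epsilon> > 0"
    and "\<And>a x. controlled_orbit b d a x \<Longrightarrow> x 0 \<in> {c..e} \<Longrightarrow>
           (\<And>n. n < N \<Longrightarrow> \<bar>a n - s\<bar> < \<epsilon>) \<Longrightarrow> \<exists>n\<le>N. x n \<in> W"
proof (rule ccontr)
  assume "\<not> thesis"
  have "\<exists>a x. controlled_orbit b d a x \<and> x 0 \<in> {c..e} \<and>
      (\<forall>n<k. \<bar>a n - s\<bar> < inverse (real (Suc k))) \<and> (\<forall>n\<le>k. x n \<notin> W)" (is "?Q k") for k
  proof (rule ccontr)
    assume "\<not> ?Q k"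
    then have "thesis"
      by (intro that[of "inverse (real (Suc k))" k]) (simp, blast)
    then show False using \<open>\<not> thesis\<close> by contradiction
  qed
  then obtain A X where orbit: "\<And>k. controlled_orbit b d (A k) (X k)"
    and start: "\<And>k. X k 0 \<in> {c..e}"
    and close: "\<And>k n. n < k \<Longrightarrow> \<bar>A k n - s\<bar> < inverse (real (Suc k))"
    and miss: "\<And>k n. n \<le> k \<Longrightarrow> X k n \<notin> W"
    by metis
  obtain y r where y: "y \<in> {c..e}" and r: "strict_mono r" "((\<lambda>k. X k 0) \<circ> r) \<longlonglongrightarrow> y"
    using seq_compactE[of "{c..e}" "\<lambda>k. X k 0"] start compact_imp_seq_compact[of "{c..e}"]
    by auto
  have A_lim: "(\<lambda>k. A (r k) n) \<longlonglongrightarrow> s" for n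
  proof -
    have "(\<lambda>k. A k n - s) \<longlonglongrightarrow> 0"
    proof (rule Lim_null_comparison[OF _ LIMSEQ_inverse_real_of_nat])
      show "eventually (\<lambda>k. norm (A k n - s) \<le> inverse (real (Suc k))) sequentially"
        using close[of n] by (auto simp: eventually_sequentially intro!: exI[of _ "Suc n"] less_imp_le)
    qed
    then have "(\<lambda>k. A k n) \<longlonglongrightarrow> s" by (simp add: LIM_zero_iff)
    from LIMSEQ_subseq_LIMSEQ[OF this r(1)] show ?thesis by (simp add: o_def)
  qed
  have X_lim: "(\<lambda>k. X (r k) n) \<longlonglongrightarrow> (G f s ^^ n) y" for n
  proof (induction n)
    case 0
    show ?case using r(2) by (simp add: o_def)
  next
    case (Suc n)
    have pos: "0 \<le> X (r k) n" for k using orbit_pos[OF orbit] by (simp add: less_imp_le)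
    have "0 \<le> (G f s ^^ n) y" by (rule LIMSEQ_le_const[OF Suc]) (use pos in auto)
    then have "(\<lambda>k. f (X (r k) n)) \<longlonglongrightarrow> f ((G f s ^^ n) y)"
      using pos by (intro continuous_on_tendsto_compose[OF continuous Suc]) auto
    then have "(\<lambda>k. (1 - A (r k) n) * f (X (r k) n) + A (r k) n * X (r k) n)
        \<longlonglongrightarrow> (1 - s) * f ((G f s ^^ n) y) + s * (G f s ^^ n) y"
      by (intro tendsto_intros A_lim Suc)
    moreover have "X (r k) (Suc n) = (1 - A (r k) n) * f (X (r k) n) + A (r k) n * X (r k) n" for k
      using orbit[of "r k"] by (simp add: controlled_orbit_def G_def)
    ultimately show ?case by (simp add: G_def[of f s "(G f s ^^ n) y"])
  qed
  obtain n where n: "(G f s ^^ n) y \<in> W" using hit[OF y] ..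
  have "eventually (\<lambda>k. X (r k) n \<in> W) sequentially"
    by (rule topological_tendstoD[OF X_lim W n])
  moreover have "eventually (\<lambda>k. X (r k) n \<notin> W) sequentially"
    using miss seq_suble[OF r(1)] by (intro eventually_sequentiallyI[of n]) (meson order_trans)
  ultimately have "eventually (\<lambda>k. False) sequentially" by eventually_elim simp
  then show False by simp
qed

text \<open>
  The deterministic core. The hypothesis on \<open>\<beta>\<close> makes every orbit under the constant control \<open>d\<close> reach
  the trapping neighbourhood that the hypothesis on \<open>b\<close> provides; an orbit with arbitrary controls
  converges to \<open>K\<close> monotonically in the end or is absorbed by a compact interval, from where one run of controls close to \<open>d\<close> imitates the constant
  control for long enough.
\<close>
lemma convergence_after_strong_control:
  assumes \<beta>: "b \<le> \<beta>" "\<beta> \<le> d"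
    and local: "0 \<le> c" "c < K" "\<And>t. c < t \<Longrightarrow> t < K \<Longrightarrow> t < G f b (G f b t)"
    and global: "\<And>t. v < t \<Longrightarrow> t < K \<Longrightarrow> t < G f \<beta> (G f \<beta> t)"
    and e: "K < e" "\<And>t. 0 \<le> t \<Longrightarrow> t \<le> K \<Longrightarrow> f t \<le> e"
    and v: "0 \<le> v" "\<And>t. K < t \<Longrightarrow> t < e \<Longrightarrow> v \<le> f t"
  obtains N \<epsilon> where "\<epsilon> > 0"
    and "\<And>a x. controlled_orbit b d a x \<Longrightarrow>
           (\<And>k. \<exists>m\<ge>k. \<forall>n<N. \<bar>a (m + n) - d\<bar> < \<epsilon>) \<Longrightarrow> x \<longlonglongrightarrow> K"
proof -
  have b1: "b < 1" using \<beta> d_less by simp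
  obtain p q where pq: "p < K" "K < q"
    and trap: "\<And>a x. controlled_orbit b d a x \<Longrightarrow> x 0 \<in> {p<..<q} \<Longrightarrow> x \<longlonglongrightarrow> K"
    using trapping_neighbourhood[OF local] by blast
  define c' where "c' = min K ((1 - b) * v + b * K)"
  have c'_pos: "0 < c'"
    using b_pos b1 v(1) K_pos unfolding c'_def by (auto intro!: add_nonneg_pos)
  have v_less: "v < t" if "c' \<le> t" "t < K" for t
  proof -
    have *: "(1 - b) * v + b * K \<le> t" using that by (auto simp: c'_def)
    have "v < K"
    proof (rule ccontr)
      assume "\<not> v < K"
      then have "(1 - b) * K \<le> (1 - b) * v" using b1 by (intro mult_left_mono) auto
      then show False using * that by (simp add: algebra_simps)
    qed
    then have "b * v < b * K" using b_pos by simp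
    then show ?thesis using * by (simp add: algebra_simps)
  qed
  have "\<exists>n. (G f d ^^ n) y \<in> {p<..<q}" if y: "y \<in> {c'..e}" for y
  proof -
    let ?x = "\<lambda>n. (G f d ^^ n) y"
    have x: "controlled_orbit b d (\<lambda>_. d) ?x" and x': "controlled_orbit \<beta> d (\<lambda>_. d) ?x"
      using \<beta> y c'_pos by (auto simp: controlled_orbit_def)
    have "?x \<longlonglongrightarrow> K"
      using orbit_tendsto_or_absorbed[OF x e v(2)]
    proof
      assume "\<exists>m. \<forall>n\<ge>m. ?x n \<in> {min K ((1 - b) * v + b * K)..e}"
      then obtain m where "\<And>n. m \<le> n \<Longrightarrow> c' \<le> ?x n" by (auto simp: c'_def)
      \<comment> \<open>The same orbit is also controlled by the interval from \<open>\<beta>\<close> to \<open>d\<close>.\<close>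
      then show ?thesis
        using crossing_equilibrium.orbit_tendsto[OF crossing_equilibrium_axioms _ d_less x', of m c']
          global v_less b_pos \<beta> by auto
    qed
    then have "eventually (\<lambda>n. ?x n \<in> {p<..<q}) sequentially"
      using pq by (intro topological_tendstoD[of ?x K]) auto
    then show ?thesis by (auto simp: eventually_sequentially)
  qed
  then obtain N \<epsilon> where \<epsilon>: "\<epsilon> > 0"
    and arrive: "\<And>a x. controlled_orbit b d a x \<Longrightarrow> x 0 \<in> {c'..e} \<Longrightarrow>
           (\<And>n. n < N \<Longrightarrow> \<bar>a n - d\<bar> < \<epsilon>) \<Longrightarrow> \<exists>n\<le>N. x n \<in> {p<..<q}"
    using uniform_arrival[of c' e d "{p<..<q}"] c'_pos
    by (metis less_imp_le open_greaterThanLessThan)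
  show thesis
  proof
    show "\<epsilon> > 0" by (rule \<epsilon>)
    fix a x
    assume x: "controlled_orbit b d a x"
      and blocks: "\<And>k. \<exists>m\<ge>k. \<forall>n<N. \<bar>a (m + n) - d\<bar> < \<epsilon>"
    show "x \<longlonglongrightarrow> K"
      using orbit_tendsto_or_absorbed[OF x e v(2)]
    proof
      assume "\<exists>m. \<forall>n\<ge>m. x n \<in> {min K ((1 - b) * v + b * K)..e}"
      then obtain k where k: "\<And>n. k \<le> n \<Longrightarrow> x n \<in> {c'..e}" unfolding c'_def by blast
      obtain m where m: "k \<le> m" "\<And>n. n < N \<Longrightarrow> \<bar>a (m + n) - d\<bar> < \<epsilon>" using blocks by blast
      obtain n where n: "x (m + n) \<in> {p<..<q}"
        using arrive[OF orbit_shift[OF x, of m]] k[of m] m by auto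
      have "(\<lambda>i. x ((m + n) + i)) \<longlonglongrightarrow> K"
        by (rule trap[OF orbit_shift[OF x, of "m + n"]]) (use n in simp)
      then have "(\<lambda>i. x (i + (m + n))) \<longlonglongrightarrow> K" by (simp add: add_ac)
      then show ?thesis by (rule LIMSEQ_offset)
    qed
  qed
qed

end

section \<open>The set of stabilising controls\<close>
lemma f_le_f_max:
  assumes "0 \<le> x" "x \<le> K"
  shows "f x \<le> f_max f K"
proof -
  have "continuous_on {0..K} f" by (rule continuous_on_subset[OF continuous]) auto
  then have "bdd_above (f ` {0..K})"
    by (intro bounded_imp_bdd_above compact_imp_bounded compact_continuous_image) auto
  then show ?thesis unfolding f_max_def using assms by (intro cSUP_upper) auto
qed

text \<open>
  If \<open>f \<le> K\<close> on \<open>[0, K]\<close>, a point near \<open>K\<close> can jump over \<open>K\<close> only downwards, by a short jump, and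
  then stays between its position and \<open>K\<close>; this is stability.
\<close>
lemma K_less_f_max:
  assumes "\<not> lyapunov_stable f K"
  shows "K < f_max f K"
proof (rule ccontr)
  assume "\<not> ?thesis"
  then have le_K: "f x \<le> K" if "0 \<le> x" "x \<le> K" for x
    using f_le_f_max[OF that] by simp
  have "lyapunov_stable f K"
    unfolding lyapunov_stable_def
  proof (intro allI impI)
    fix \<epsilon> :: real assume \<epsilon>: "\<epsilon> > 0"
    have "isCont f K"
      by (rule continuous_on_interior[OF continuous]) (use K_pos in auto)
    then obtain \<delta> where \<delta>: "\<delta> > 0" "\<And>x. \<bar>x - K\<bar> < \<delta> \<Longrightarrow> \<bar>f x - K\<bar> < \<epsilon>"
      using \<epsilon> fixed unfolding continuous_at_eps_delta dist_real_def by metis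
    have step: "0 \<le> f x \<and> K - \<epsilon> < f x \<and> f x < K + min \<epsilon> \<delta>"
      if x: "0 \<le> x" "K - \<epsilon> < x" "x < K + min \<epsilon> \<delta>" for x
    proof (cases "x \<le> K")
      case True
      then show ?thesis using le_f[of x] le_K[of x] x nonneg[of x] \<epsilon> \<delta>(1) by auto
    next
      case False
      then have "\<bar>x - K\<bar> < \<delta>" using x by simp
      then show ?thesis using f_le[of x] \<delta>(2)[of x] x nonneg[of x] False by (simp add: abs_less_iff)
    qed
    show "\<exists>\<delta>>0. \<forall>x\<ge>0. \<bar>x - K\<bar> < \<delta> \<longrightarrow> (\<forall>n. \<bar>(f ^^ n) x - K\<bar> < \<epsilon>)"
    proof (intro exI[of _ "min \<epsilon> \<delta>"] conjI allI impI)
      fix x n assume x: "0 \<le> x" "\<bar>x - K\<bar> < min \<epsilon> \<delta>"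
      have "0 \<le> (f ^^ n) x \<and> K - \<epsilon> < (f ^^ n) x \<and> (f ^^ n) x < K + min \<epsilon> \<delta>"
      proof (induction n)
        case (Suc n)
        then show ?case using step[of "(f ^^ n) x"] by simp
      qed (use x in auto)
      then show "\<bar>(f ^^ n) x - K\<bar> < \<epsilon>" by auto
    qed (use \<epsilon> \<delta>(1) in auto)
  qed
  with assms show False ..
qed

lemma f2_min_le:
  assumes "K < x" "x < f_max f K"
  shows "f2_min f K \<le> f x"
  unfolding f2_min_def
proof (rule cINF_lower)
  show "bdd_below (f ` {K<..<f_max f K})"
    by (rule bdd_belowI2[of _ 0]) (use nonneg K_pos in auto)
qed (use assms in simp)

lemma f2_min_nonneg:
  assumes "K < f_max f K"
  shows "0 \<le> f2_min f K"
  unfolding f2_min_def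
  by (rule cINF_greatest) (use assms nonneg K_pos in auto)

text \<open>
  With steps of size at most \<open>\<delta>\<close>, a point at distance at least \<open>\<delta>\<close> to the left of \<open>K\<close> does not cross \<open>K\<close>,
  so both steps go upwards; closer points are covered by the hypothesis. The condition on the right of
  \<open>K\<close> follows from the one on the left: if \<open>F\<^sub>a (F\<^sub>a t) \<ge> t > K\<close>, then some \<open>r\<close> between \<open>F\<^sub>a t\<close> and \<open>K\<close> has
  \<open>F\<^sub>a r = t\<close>, and \<open>F\<^sub>a (F\<^sub>a r) = F\<^sub>a t \<le> r\<close>.
\<close>
lemma weak_step_in_S_set:
  assumes a: "0 < a" "a < 1" and \<delta>: "0 < \<delta>" and f2_min: "0 \<le> f2_min f K"
    and small: "(1 - a) * (f_max f K + \<delta>) \<le> \<delta>"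
    and local: "\<And>t. K - \<delta> < t \<Longrightarrow> t < K \<Longrightarrow> t < G f a (G f a t)"
  shows "a \<in> S_set f K"
proof -
  have move: "(1 - a) * y \<le> \<delta>" if "y \<le> f_max f K + \<delta>" for y
    using mult_left_mono[OF that, of "1 - a"] small a by linarith
  have left: "t < G f a (G f a t)" if t: "0 < t" "t < K" for t
  proof (cases "K - \<delta> < t")
    case True
    then show ?thesis using local t by simp
  next
    case False
    have "(1 - a) * (f t - t) \<le> \<delta>"
      using f_le_f_max[of t] t \<delta> by (intro move) auto
    then have "G f a t \<le> K" using False by (simp add: G_eq_move)
    moreover have "t < G f a t" using G_gt_self a t by simp
    ultimately show ?thesis using G_ge_self[of a "G f a t"] a t by linarith
  qed
  have right: "G f a (G f a t) < t" if t: "K < t" "t < f_max f K" for t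
  proof (rule ccontr)
    assume "\<not> ?thesis"
    then have ge: "t \<le> G f a (G f a t)" by simp
    let ?s = "G f a t"
    have "?s < t" using G_lt_self a t by simp
    then have s_less: "?s < K" using ge G_le_self[of a ?s] a by force
    have s_pos: "0 < ?s" using G_pos a t K_pos by simp
    have "\<exists>r\<ge>?s. r \<le> K \<and> G f a r = t"
      by (rule IVT2') (use ge t s_less s_pos in
        \<open>auto simp: G_fixed intro: continuous_on_subset[OF continuous_on_G]\<close>)
    then obtain r where r: "?s \<le> r" "r \<le> K" "G f a r = t" by blast
    then have "r < K" using t by (cases "r = K") (auto simp: G_fixed)
    then show False using left[of r] r s_pos by simp
  qed
  show ?thesis unfolding S_set_def using a left right f2_min by auto
qed

lemma S_set_nonempty:
  assumes unstable: "\<not> lyapunov_stable f K"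
    and \<alpha>: "0 < \<alpha>" "\<alpha> < 1" and \<delta>: "0 < \<delta>"
    and local: "\<And>a t. \<alpha> < a \<Longrightarrow> a < 1 \<Longrightarrow> K - \<delta> < t \<Longrightarrow> t < K \<Longrightarrow> t < G f a (G f a t)"
  shows "S_set f K \<noteq> {}"
proof -
  have f_max: "K < f_max f K" by (rule K_less_f_max[OF unstable])
  define a where "a = max ((1 + \<alpha>) / 2) (1 - \<delta> / (f_max f K + \<delta>))"
  have "(1 - a) * (f_max f K + \<delta>) \<le> (\<delta> / (f_max f K + \<delta>)) * (f_max f K + \<delta>)"
    using f_max K_pos \<delta> by (intro mult_right_mono) (auto simp: a_def)
  then have "(1 - a) * (f_max f K + \<delta>) \<le> \<delta>" using f_max K_pos \<delta> by simp
  moreover have "\<alpha> < a" "a < 1"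
    using \<alpha> \<delta> f_max K_pos by (auto simp: a_def less_max_iff_disj)
  ultimately have "a \<in> S_set f K"
    using \<alpha> \<delta> f_max f2_min_nonneg local by (intro weak_step_in_S_set[of a \<delta>]) auto
  then show ?thesis by blast
qed

end

lemma assumption_A_crossing_equilibrium:
  assumes "assumption_A f K"
  shows "crossing_equilibrium f K"
  using assms unfolding assumption_A_def by unfold_locales auto

section \<open>Runs of favourable noise\<close>

text \<open>
  Disjoint blocks of \<open>N\<close> events are again independent, each with probability \<open>r ^ N\<close>. So infinitely
  many blocks occur with probability at least \<open>r ^ N > 0\<close>, hence with probability 1 by the zero-one law.
\<close>
lemma (in prob_space) AE_infinitely_many_blocks:
  fixes A :: "nat \<Rightarrow> 'a set"
  assumes indep: "indep_events A {1..}"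
    and prob: "\<And>n. n \<ge> 1 \<Longrightarrow> prob (A n) = r" and r: "0 < r"
  shows "AE \<omega> in M. \<forall>k. \<exists>m\<ge>k. \<forall>i<N. \<omega> \<in> A (Suc (m + i))"
proof (cases "N = 0")
  case False
  define I where "I j = {Suc (j * N)..j * N + N}" for j
  define B where "B j = (\<Inter>i\<in>I j. A i)" for j
  have I: "finite (I j)" "I j \<noteq> {}" "I j \<subseteq> {1..}" "card (I j) = N" for j
    using False by (auto simp: I_def)
  have disj: "I i \<inter> I j = {}" if "i \<noteq> j" for i j
  proof -
    have "I i \<inter> I j = {}" if "i < j" for i j
    proof -
      have "Suc i * N \<le> j * N" using that by (intro mult_right_mono) auto
      then show ?thesis by (auto simp: I_def)
    qed
    then show ?thesis using \<open>i \<noteq> j\<close> by (metis inf_commute linorder_neq_iff)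
  qed
  have prod: "prob (\<Inter>i\<in>J. A i) = r ^ card J" if "J \<subseteq> {1..}" "J \<noteq> {}" "finite J" for J
  proof -
    have "prob (\<Inter>i\<in>J. A i) = (\<Prod>i\<in>J. prob (A i))"
      using indep that unfolding indep_events_def by blast
    also have "\<dots> = r ^ card J" using prob that by (subst prod.cong[OF refl, of J _ "\<lambda>_. r"]) auto
    finally show ?thesis .
  qed
  have B_sets: "B j \<in> events" for j
    unfolding B_def using I[of j] indep
    by (intro sets.finite_INT) (auto simp: indep_events_def)
  have B_prob: "prob (B j) = r ^ N" for j unfolding B_def using prod[of "I j"] I by simp
  have "indep_events B UNIV"
  proof (rule indep_eventsI)
    fix J :: "nat set" assume J: "finite J" "J \<noteq> {}"
    have union: "(\<Union>j\<in>J. I j) \<subseteq> {1..}" "(\<Union>j\<in>J. I j) \<noteq> {}" "finite (\<Union>j\<in>J. I j)"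
      using I(3) by (rule UN_least) (simp_all add: I(1,2) J)
    have "(\<Inter>j\<in>J. B j) = (\<Inter>i\<in>(\<Union>j\<in>J. I j). A i)" by (auto simp: B_def)
    then have "prob (\<Inter>j\<in>J. B j) = r ^ card (\<Union>j\<in>J. I j)"
      using prod[of "\<Union>j\<in>J. I j"] union by simp
    also have "card (\<Union>j\<in>J. I j) = N * card J"
      using J I disj by (subst card_UN_disjoint) auto
    also have "r ^ (N * card J) = (\<Prod>j\<in>J. prob (B j))"
      by (simp add: B_prob power_mult)
    finally show "prob (\<Inter>j\<in>J. B j) = (\<Prod>j\<in>J. prob (B j))" .
  qed (rule B_sets)
  then have zero_one: "prob (\<Inter>n. \<Union>m\<in>{n..}. B m) = 0 \<or> prob (\<Inter>n. \<Union>m\<in>{n..}. B m) = 1"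
    by (rule borel_0_1_law)
  have "(\<lambda>n. prob (\<Union>m\<in>{n..}. B m)) \<longlonglongrightarrow> prob (\<Inter>n. \<Union>m\<in>{n..}. B m)"
    using B_sets by (intro finite_Lim_measure_decseq) (auto simp: decseq_def intro: order_trans)
  moreover have "r ^ N \<le> prob (\<Union>m\<in>{n..}. B m)" for n
    unfolding B_prob[of n, symmetric] using B_sets by (intro finite_measure_mono) auto
  ultimately have "r ^ N \<le> prob (\<Inter>n. \<Union>m\<in>{n..}. B m)"
    by (intro LIMSEQ_le_const) auto
  then have "prob (\<Inter>n. \<Union>m\<in>{n..}. B m) = 1"
    using zero_one zero_less_power[OF r, of N] by linarith
  then have "AE \<omega> in M. \<omega> \<in> (\<Inter>n. \<Union>m\<in>{n..}. B m)"
    using B_sets by (subst (asm) prob_eq_1) auto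
  then show ?thesis
  proof (rule AE_mp, intro AE_I2 impI allI)
    fix \<omega> k assume "\<omega> \<in> (\<Inter>n. \<Union>m\<in>{n..}. B m)"
    then obtain j where j: "k \<le> j" "\<omega> \<in> B j" by blast
    have "j * 1 \<le> j * N" using False by (intro mult_left_mono) auto
    then have "k \<le> j * N" using j(1) by linarith
    moreover have "\<omega> \<in> A (Suc (j * N + i))" if "i < N" for i
      using j(2) that by (auto simp: B_def I_def)
    ultimately show "\<exists>m\<ge>k. \<forall>i<N. \<omega> \<in> A (Suc (m + i))" by blast
  qed
qed auto

section \<open>Almost sure convergence\<close>
theorem theorem2:
  fixes M :: "'a measure" and \<xi> :: "nat \<Rightarrow> 'a \<Rightarrow> real"
    and f :: "real \<Rightarrow> real" and K \<delta>\<^sub>0 \<alpha>\<^sub>0 \<alpha> l x\<^sub>0 :: real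
    and x :: "nat \<Rightarrow> 'a \<Rightarrow> real"
  assumes noise: "noise_assumption M \<xi>"
    and f: "assumption_A f K"
    and \<delta>\<^sub>0: "\<delta>\<^sub>0 \<in> {0<..<K}"
    and \<alpha>\<^sub>0: "\<alpha>\<^sub>0 \<in> {0<..<1}"
    and deterministic: "\<And>a y. \<lbrakk>a \<in> {\<alpha>\<^sub>0<..<1}; y 0 \<in> {K - \<delta>\<^sub>0<..<K + \<delta>\<^sub>0};
        \<And>n. y (Suc n) = (1 - a) * f (y n) + a * y n\<rbrakk> \<Longrightarrow> y \<longlonglongrightarrow> K"
    and \<alpha>: "\<alpha> \<in> {(\<alpha>\<^sub>0 + beta_low f K) / 2<..<beta_low f K}"
    and l: "l \<in> {beta_low f K - \<alpha><..<min (\<alpha> - \<alpha>\<^sub>0) (1 - \<alpha>)}"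
    and x\<^sub>0: "x\<^sub>0 > 0"
    and init: "\<And>\<omega>. \<omega> \<in> space M \<Longrightarrow> x 0 \<omega> = x\<^sub>0"
    and step: "\<And>n \<omega>. \<omega> \<in> space M \<Longrightarrow>
        x (Suc n) \<omega> = (1 - \<alpha> - l * \<xi> (Suc n) \<omega>) * f (x n \<omega>) + (\<alpha> + l * \<xi> (Suc n) \<omega>) * x n \<omega>"
  shows "AE \<omega> in M. (\<lambda>n. x n \<omega>) \<longlonglongrightarrow> K"
proof -
  interpret E: crossing_equilibrium f K
    by (rule assumption_A_crossing_equilibrium[OF f])
  interpret prob_space M using noise by (simp add: noise_assumption_def)
  have unstable: "\<not> lyapunov_stable f K" using f by (simp add: assumption_A_def)
  define b d where "b = \<alpha> - l" and "d = \<alpha> + l"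
  have b: "\<alpha>\<^sub>0 < b" and d: "beta_low f K < d" "d < 1" and l_pos: "0 < l"
    using \<alpha> l by (auto simp: b_def d_def)
  have b_pos: "0 < b" using b \<alpha>\<^sub>0 by simp
  have local: "t < G f a (G f a t)" if "\<alpha>\<^sub>0 < a" "a < 1" "K - \<delta>\<^sub>0 < t" "t < K" for a t
  proof (rule E.attraction_imp_second_iterate_gt[of a "K - \<delta>\<^sub>0"])
    show "(\<lambda>n. (G f a ^^ n) y) \<longlonglongrightarrow> K" if "K - \<delta>\<^sub>0 < y" "y < K" for y
      using that \<open>\<alpha>\<^sub>0 < a\<close> \<open>a < 1\<close> \<delta>\<^sub>0 by (intro deterministic[of a]) (auto simp: G_def)
  qed (use that \<alpha>\<^sub>0 \<delta>\<^sub>0 in auto)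
  have "S_set f K \<noteq> {}"
    using \<alpha>\<^sub>0 \<delta>\<^sub>0 local by (intro E.S_set_nonempty[OF unstable, of \<alpha>\<^sub>0 \<delta>\<^sub>0]) auto
  then obtain \<beta> where \<beta>: "\<beta> \<in> S_set f K" "\<beta> < d"
    using d(1) cInf_lessD unfolding beta_low_def by blast
  have "beta_low f K \<le> \<beta>"
    unfolding beta_low_def
    by (rule cInf_lower[OF \<beta>(1)]) (auto simp: S_set_def bdd_below_def intro!: exI[of _ 0])
  then have "b \<le> \<beta>" using \<alpha> l_pos by (auto simp: b_def)
  have f_max: "K < f_max f K" by (rule E.K_less_f_max[OF unstable])
  obtain N \<epsilon> where \<epsilon>: "\<epsilon> > 0"
    and converge: "\<And>a x. E.controlled_orbit b d a x \<Longrightarrow>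
           (\<And>k. \<exists>m\<ge>k. \<forall>n<N. \<bar>a (m + n) - d\<bar> < \<epsilon>) \<Longrightarrow> x \<longlonglongrightarrow> K"
  proof (rule E.convergence_after_strong_control[OF b_pos d(2) \<open>b \<le> \<beta>\<close>, of "K - \<delta>\<^sub>0" "f2_min f K" "f_max f K"])
    show "t < G f b (G f b t)" if "K - \<delta>\<^sub>0 < t" "t < K" for t
      using local[of b t] b that \<beta>(2) \<open>b \<le> \<beta>\<close> d(2) by simp
    show "t < G f \<beta> (G f \<beta> t)" if "f2_min f K < t" "t < K" for t
      using \<beta>(1) that by (simp add: S_set_def)
  qed (use \<beta>(2) \<delta>\<^sub>0 f_max E.f_le_f_max E.f2_min_nonneg[OF f_max] E.f2_min_le in auto)
  \<comment> \<open>The events that \<open>\<xi> n\<close> brings the control to within \<open>\<epsilon>\<close> of \<open>d\<close>.\<close>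
  define A where "A n = {\<omega> \<in> space M. \<xi> n \<omega> \<in> {1 - \<epsilon> / l<..1}}" for n
  have indep_\<xi>: "indep_vars (\<lambda>_. borel) \<xi> {1..}"
    and dist: "\<And>n. n \<ge> 1 \<Longrightarrow> distr M borel (\<xi> n) = distr M borel (\<xi> 1)"
    and bounded: "\<And>n \<omega>. n \<ge> 1 \<Longrightarrow> \<omega> \<in> space M \<Longrightarrow> \<bar>\<xi> n \<omega>\<bar> \<le> 1"
    and positive: "0 < measure M (A 1)"
    using noise unfolding noise_assumption_def A_def by (blast, blast, blast, simp add: \<epsilon> l_pos)
  have indep: "indep_events A {1..}"
    using indep_eventsI_indep_vars[OF indep_\<xi>, of "\<lambda>_ y. y \<in> {1 - \<epsilon> / l<..1}"]
    by (simp add: A_def[abs_def])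
  have A_prob: "prob (A n) = measure (distr M borel (\<xi> n)) {1 - \<epsilon> / l<..1}" if "n \<ge> 1" for n
  proof -
    have "\<xi> n \<in> borel_measurable M" using indep_\<xi> that by (simp add: indep_vars_def)
    then show ?thesis by (simp add: measure_distr A_def vimage_def Int_def conj_commute)
  qed
  have "prob (A n) = prob (A 1)" if "n \<ge> 1" for n
    using A_prob[OF that] A_prob[of 1] dist[OF that] by simp
  then have "AE \<omega> in M. \<forall>k. \<exists>m\<ge>k. \<forall>n<N. \<omega> \<in> A (Suc (m + n))"
    by (intro AE_infinitely_many_blocks[OF indep _ positive])
  then show ?thesis
  proof (rule AE_mp, intro AE_I2 impI)
    fix \<omega>
    assume \<omega>: "\<omega> \<in> space M" and blocks: "\<forall>k. \<exists>m\<ge>k. \<forall>n<N. \<omega> \<in> A (Suc (m + n))"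
    define a where "a n = \<alpha> + l * \<xi> (Suc n) \<omega>" for n
    have "\<bar>l * \<xi> (Suc n) \<omega>\<bar> \<le> l" for n
      using bounded[of "Suc n" \<omega>] \<omega> l_pos mult_left_le[of "\<bar>\<xi> (Suc n) \<omega>\<bar>" l]
      by (simp add: abs_mult)
    then have a: "b \<le> a n" "a n \<le> d" for n
      unfolding a_def b_def d_def by (smt (verit))+
    have "x (Suc n) \<omega> = G f (a n) (x n \<omega>)" for n
      using step[OF \<omega>, of n] by (simp add: G_def a_def diff_diff_eq)
    then have orbit: "E.controlled_orbit b d a (\<lambda>n. x n \<omega>)"
      using a init[OF \<omega>] x\<^sub>0 by (simp add: E.controlled_orbit_def)
    have close: "\<bar>a n - d\<bar> < \<epsilon>" if "\<omega> \<in> A (Suc n)" for n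
    proof -
      have "1 - \<xi> (Suc n) \<omega> < \<epsilon> / l" using that by (simp add: A_def)
      then have "l * (1 - \<xi> (Suc n) \<omega>) < \<epsilon>" using l_pos by (simp add: field_simps)
      then have "d - a n < \<epsilon>" by (simp add: a_def d_def algebra_simps)
      then show ?thesis using a[of n] by simp
    qed
    show "(\<lambda>n. x n \<omega>) \<longlonglongrightarrow> K"
      using blocks close by (intro converge[OF orbit]) meson
  qed
qed

end
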